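(* Let points $M_1,\dots,M_N\in\mathbb R^k$ with masses $m_1,\dots,m_N>0$ be given, not all contained in one hyperplane, with total mass $m$, center of masses $C$ and central principal hyperplanar moments of inertia $0<J_1<\dots<J_k$. Use Cartesian coordinates with origin $C$ along the principal axes at $C$ and consider the associated pencil of confocal quadrics $$\frac{x_1^2}{\frac{J_1}{m}-\lambda}+\frac{x_2^2}{\frac{J_1}{m}-a_2^2-\lambda}+\dots+\frac{x_k^2}{\frac{J_1}{m}-a_k^2-\lambda}=1,\qquad a_s^2=\frac{J_s-J_1}{m}.$$ Let a point $P$ be given. (i) For $k=2$ let $P$ have Jacobi coordinates $\lambda_1<\lambda_2$. The line which is the best fit for the given system of points among the lines which contain $P$ is the tangent line $t_2$ at $P$ to the hyperbola with parameter $\lambda=\lambda_2$. The line which is the worst fit among the lines which contain $P$ is the tangent line $t_1$ at $P$ to the ellipse with parameter $\lambda=\lambda_1$. The tangents $t_1,t_2$ solve Restricted PCA restricted at $P$. (ii) For $k=3$ let $P$ have Jacobi coordinates $\lambda_1<\lambda_2<\lambda_3$. The plane which is the best fit for the given system of points among the planes which contain $P$ is the tangent plane at $P$ to the two-sheeted hyperboloid with parameter $\lambda=\lambda_3$. The plane which is the worst fit among the planes which contain $P$ is the tangent plane at $P$ to the ellipsoid with parameter $\lambda=\lambda_1$. The lines of intersection of each two of the three tangent planes at $P$ to the quadrics with parameters $\lambda_1,\lambda_2,\lambda_3$ solve Restricted PCA restricted at $P$.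
   Context: For a hyperplane $\pi$ (a line if $k=2$, a plane if $k=3$), $J_\pi=\sum_{i=1}^N m_i d_i^2$, with $d_i$ the perpendicular distance from $M_i$ to $\pi$. Best fit (worst fit) means minimizing (maximizing) $J_\pi$. The hyperplanar operator of inertia at a point $P$ is the symmetric operator with $\langle J_P\mathbf n_1,\mathbf n_2\rangle=\sum_{j} m_j\langle \mathbf r_j,\mathbf n_1\rangle\langle\mathbf r_j,\mathbf n_2\rangle$, $\mathbf r_j=M_j-P$. The eigenvalues of $J_C$ are the central principal moments $J_1,\dots,J_k$, and its orthonormal eigenvectors are the principal axes at $C$ (the $x_i$-axis corresponds to $J_i$). Write $\alpha_1=J_1/m$, $\alpha_s=J_1/m-a_s^2$ for $s\ge2$. The Jacobi coordinates of $P=(x_{01},\dots,x_{0k})$ are the solutions $\lambda$ of the pencil equation with $x_i=x_{0i}$, i.e. the roots of $\prod_i(\alpha_i-\lambda)-\sum_i x_{0i}^2\prod_{j\neq i}(\alpha_j-\lambda)=0$. Degenerate members: for $\lambda=\alpha_i$ the member of the pencil is the coordinate hyperplane $x_i=0$, its own tangent hyperplane; when a parameter $\lambda_i$ is one of these values the degenerate member plays the role of the ellipse, hyperbola, ellipsoid or hyperboloid in question. Restricted PCA at $P$: find successively unit vectors $n_1,\dots,n_k$ such that $n_j$ maximizes $n^TJ_Pn$ among unit vectors $n$ satisfying $n^TJ_Pn_i=0$ for all $i<j$. A collection of $k$ lines through $P$ solves Restricted PCA at $P$ if these lines are, in some order, the lines through $P$ in the directions $n_1,\dots,n_k$. *)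

theory Defs
  imports "HOL-Analysis.Analysis"
begin

definition is_hyperplane :: "(real^'n) set \<Rightarrow> bool" where
  "is_hyperplane \<pi> \<longleftrightarrow> (\<exists>a b. a \<noteq> 0 \<and> \<pi> = {x. a \<bullet> x = b})"

definition total_mass :: "nat \<Rightarrow> (nat \<Rightarrow> real) \<Rightarrow> real" where
  "total_mass N w = (\<Sum>i=1..N. w i)"

definition center_of_mass :: "nat \<Rightarrow> (nat \<Rightarrow> real) \<Rightarrow> (nat \<Rightarrow> real^'n) \<Rightarrow> real^'n" where
  "center_of_mass N w M = (1 / total_mass N w) *\<^sub>R (\<Sum>i=1..N. w i *\<^sub>R M i)"

definition hyperplanar_moment ::
  "nat \<Rightarrow> (nat \<Rightarrow> real) \<Rightarrow> (nat \<Rightarrow> real^'n) \<Rightarrow> (real^'n) set \<Rightarrow> real" where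
  "hyperplanar_moment N w M \<pi> = (\<Sum>i=1..N. w i * (infdist (M i) \<pi>)\<^sup>2)"

definition best_fit_through ::
  "nat \<Rightarrow> (nat \<Rightarrow> real) \<Rightarrow> (nat \<Rightarrow> real^'n) \<Rightarrow> real^'n \<Rightarrow> (real^'n) set \<Rightarrow> bool" where
  "best_fit_through N w M P \<pi> \<longleftrightarrow> is_hyperplane \<pi> \<and> P \<in> \<pi> \<and>
     (\<forall>\<pi>'. is_hyperplane \<pi>' \<and> P \<in> \<pi>' \<longrightarrow> hyperplanar_moment N w M \<pi> \<le> hyperplanar_moment N w M \<pi>')"

definition worst_fit_through ::
  "nat \<Rightarrow> (nat \<Rightarrow> real) \<Rightarrow> (nat \<Rightarrow> real^'n) \<Rightarrow> real^'n \<Rightarrow> (real^'n) set \<Rightarrow> bool" where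
  "worst_fit_through N w M P \<pi> \<longleftrightarrow> is_hyperplane \<pi> \<and> P \<in> \<pi> \<and>
     (\<forall>\<pi>'. is_hyperplane \<pi>' \<and> P \<in> \<pi>' \<longrightarrow> hyperplanar_moment N w M \<pi>' \<le> hyperplanar_moment N w M \<pi>)"

text \<open>The operator is given explicitly; the two lemmas below show that it is the one and only
  operator with the prescribed bilinear form.\<close>

definition inertia ::
  "nat \<Rightarrow> (nat \<Rightarrow> real) \<Rightarrow> (nat \<Rightarrow> real^'n) \<Rightarrow> real^'n \<Rightarrow> real^'n \<Rightarrow> real^'n" where
  "inertia N w M P n = (\<Sum>j=1..N. (w j * ((M j - P) \<bullet> n)) *\<^sub>R (M j - P))"

lemma inertia_inner:
  "inertia N w M P n1 \<bullet> n2 = (\<Sum>j=1..N. w j * ((M j - P) \<bullet> n1) * ((M j - P) \<bullet> n2))"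
  by (simp add: inertia_def inner_sum_left)

lemma inertia_unique:
  assumes "\<And>n1 n2. A n1 \<bullet> n2 = (\<Sum>j=1..N. w j * ((M j - P) \<bullet> n1) * ((M j - P) \<bullet> n2))"
  shows "A = inertia N w M P"
proof
  fix n
  have "\<forall>z. A n \<bullet> z = inertia N w M P n \<bullet> z"
    by (simp add: assms inertia_inner)
  then show "A n = inertia N w M P n"
    by (simp only: vector_eq_rdot)
qed

text \<open>Principal axes and the corresponding moments at a point are indexed by
  \<open>1, \<dots>, k\<close> with \<open>k = CARD('n)\<close>; values at other indices are irrelevant.
  An orthonormal family of this size is a basis, so the \<open>J i\<close> are all the eigenvalues.\<close>

definition principal_frame ::
  "nat \<Rightarrow> (nat \<Rightarrow> real) \<Rightarrow> (nat \<Rightarrow> real^'n) \<Rightarrow> real^'n \<Rightarrow> (nat \<Rightarrow> real^'n) \<Rightarrow> (nat \<Rightarrow> real) \<Rightarrow> bool" where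
  "principal_frame N w M Q e J \<longleftrightarrow>
     (\<forall>i\<in>{1..CARD('n)}. \<forall>j\<in>{1..CARD('n)}. e i \<bullet> e j = (if i = j then 1 else 0)) \<and>
     (\<forall>i\<in>{1..CARD('n)}. inertia N w M Q (e i) = J i *\<^sub>R e i)"

definition frame_coord :: "real^'n \<Rightarrow> (nat \<Rightarrow> real^'n) \<Rightarrow> nat \<Rightarrow> real^'n \<Rightarrow> real" where
  "frame_coord C e i X = (X - C) \<bullet> e i"

definition pencil_a_sq :: "real \<Rightarrow> (nat \<Rightarrow> real) \<Rightarrow> nat \<Rightarrow> real" where
  "pencil_a_sq m J s = (J s - J 1) / m"

text \<open>Since \<open>pencil_a_sq m J 1 = 0\<close>, the formula also covers the first
  parameter, \<open>J 1 / m\<close>.\<close>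

definition pencil_alpha :: "real \<Rightarrow> (nat \<Rightarrow> real) \<Rightarrow> nat \<Rightarrow> real" where
  "pencil_alpha m J s = J 1 / m - pencil_a_sq m J s"

definition degenerate_param :: "(nat \<Rightarrow> real) \<Rightarrow> nat \<Rightarrow> real \<Rightarrow> bool" where
  "degenerate_param \<alpha> k \<mu> \<longleftrightarrow> (\<exists>i\<in>{1..k}. \<mu> = \<alpha> i)"

text \<open>A defining function of the member of the pencil with parameter \<open>\<mu>\<close>. For
  \<open>\<mu> = \<alpha> i\<close> the member is the coordinate hyperplane \<open>x i = 0\<close>; the index
  \<open>i\<close> is unique because the \<open>\<alpha> i\<close> are pairwise distinct.\<close>

definition pencil_fun ::
  "real^'n \<Rightarrow> (nat \<Rightarrow> real^'n) \<Rightarrow> (nat \<Rightarrow> real) \<Rightarrow> real \<Rightarrow> real^'n \<Rightarrow> real" where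
  "pencil_fun C e \<alpha> \<mu> X =
     (if degenerate_param \<alpha> CARD('n) \<mu>
      then frame_coord C e (THE i. i \<in> {1..CARD('n)} \<and> \<mu> = \<alpha> i) X
      else (\<Sum>i=1..CARD('n). (frame_coord C e i X)\<^sup>2 / (\<alpha> i - \<mu>)) - 1)"

definition pencil_member ::
  "real^'n \<Rightarrow> (nat \<Rightarrow> real^'n) \<Rightarrow> (nat \<Rightarrow> real) \<Rightarrow> real \<Rightarrow> (real^'n) set" where
  "pencil_member C e \<alpha> \<mu> = {X. pencil_fun C e \<alpha> \<mu> X = 0}"

text \<open>The hyperplane through \<open>P\<close> on which the differential of the defining function
  vanishes. This is meant for \<open>P\<close> on the member, where the differential is never zero.\<close>

definition tangent_at ::
  "real^'n \<Rightarrow> (nat \<Rightarrow> real^'n) \<Rightarrow> (nat \<Rightarrow> real) \<Rightarrow> real \<Rightarrow> real^'n \<Rightarrow> (real^'n) set" where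
  "tangent_at C e \<alpha> \<mu> P = {X. frechet_derivative (pencil_fun C e \<alpha> \<mu>) (at P) (X - P) = 0}"

lemma tangent_at_nondegenerate:
  fixes P :: "real^'n"
  assumes nd: "\<not> degenerate_param \<alpha> CARD('n) \<mu>"
    and P: "P \<in> pencil_member C e \<alpha> \<mu>"
  shows "tangent_at C e \<alpha> \<mu> P =
    {X. (\<Sum>i=1..CARD('n). frame_coord C e i P * frame_coord C e i X / (\<alpha> i - \<mu>)) = 1}"
proof -
  have "(pencil_fun C e \<alpha> \<mu> has_derivative
      (\<lambda>h. \<Sum>i=1..CARD('n). 2 * frame_coord C e i P * (h \<bullet> e i) / (\<alpha> i - \<mu>))) (at P)"
  proof -
    have f: "pencil_fun C e \<alpha> \<mu> =
        (\<lambda>X. (\<Sum>i=1..CARD('n). ((X - C) \<bullet> e i)\<^sup>2 * inverse (\<alpha> i - \<mu>)) - 1)"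
      using nd by (auto simp: pencil_fun_def frame_coord_def divide_inverse)
    have "((\<lambda>X. ((X - C) \<bullet> e i)\<^sup>2 * inverse (\<alpha> i - \<mu>)) has_derivative
        (\<lambda>h. 2 * frame_coord C e i P * (h \<bullet> e i) / (\<alpha> i - \<mu>))) (at P)" for i
      by (rule has_derivative_eq_rhs, (rule derivative_intros)+)
        (auto simp: frame_coord_def divide_inverse fun_eq_iff)
    then have "((\<lambda>X. (\<Sum>i=1..CARD('n). ((X - C) \<bullet> e i)\<^sup>2 * inverse (\<alpha> i - \<mu>)) - 1) has_derivative
        (\<lambda>h. (\<Sum>i=1..CARD('n). 2 * frame_coord C e i P * (h \<bullet> e i) / (\<alpha> i - \<mu>)) - 0)) (at P)"
      by (intro has_derivative_diff has_derivative_sum has_derivative_const)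
    then show ?thesis
      by (simp add: f)
  qed
  then have fd: "frechet_derivative (pencil_fun C e \<alpha> \<mu>) (at P) =
      (\<lambda>h. \<Sum>i=1..CARD('n). 2 * frame_coord C e i P * (h \<bullet> e i) / (\<alpha> i - \<mu>))"
    by (rule frechet_derivative_at [symmetric])
  have one: "(\<Sum>i=1..CARD('n). (frame_coord C e i P)\<^sup>2 / (\<alpha> i - \<mu>)) = 1"
    using P nd by (simp add: pencil_member_def pencil_fun_def)
  have "(\<Sum>i=1..CARD('n). 2 * frame_coord C e i P * ((X - P) \<bullet> e i) / (\<alpha> i - \<mu>)) =
      2 * ((\<Sum>i=1..CARD('n). frame_coord C e i P * frame_coord C e i X / (\<alpha> i - \<mu>)) - 1)" for X
    unfolding one [symmetric] sum_distrib_left sum_subtractf [symmetric] frame_coord_def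
    by (rule sum.cong) (auto simp: algebra_simps power2_eq_square diff_divide_distrib add_divide_distrib)
  then show ?thesis
    by (auto simp: tangent_at_def fd)
qed

lemma tangent_at_degenerate:
  fixes P :: "real^'n"
  assumes d: "degenerate_param \<alpha> CARD('n) \<mu>"
    and P: "P \<in> pencil_member C e \<alpha> \<mu>"
  shows "tangent_at C e \<alpha> \<mu> P = pencil_member C e \<alpha> \<mu>"
proof -
  define i where "i = (THE i. i \<in> {1..CARD('n)} \<and> \<mu> = \<alpha> i)"
  have f: "pencil_fun C e \<alpha> \<mu> = (\<lambda>X. (X - C) \<bullet> e i)"
    using d by (auto simp: pencil_fun_def frame_coord_def i_def)
  have "((\<lambda>X. (X - C) \<bullet> e i) has_derivative (\<lambda>h. h \<bullet> e i)) (at P)"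
    by (auto intro!: derivative_eq_intros)
  then have "frechet_derivative (pencil_fun C e \<alpha> \<mu>) (at P) = (\<lambda>h. h \<bullet> e i)"
    unfolding f by (rule frechet_derivative_at [symmetric])
  then show ?thesis
    using P by (auto simp: tangent_at_def pencil_member_def f inner_diff_left)
qed

text \<open>All semi-axes real: an ellipse for \<open>k = 2\<close>, an ellipsoid for \<open>k = 3\<close>.\<close>

definition ellipsoid_param :: "(nat \<Rightarrow> real) \<Rightarrow> nat \<Rightarrow> real \<Rightarrow> bool" where
  "ellipsoid_param \<alpha> k \<mu> \<longleftrightarrow> (\<forall>i\<in>{1..k}. 0 < \<alpha> i - \<mu>)"

text \<open>Exactly one positive denominator, the others negative: a hyperbola for \<open>k = 2\<close>,
  a two-sheeted hyperboloid for \<open>k = 3\<close>.\<close>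

definition two_sheeted_param :: "(nat \<Rightarrow> real) \<Rightarrow> nat \<Rightarrow> real \<Rightarrow> bool" where
  "two_sheeted_param \<alpha> k \<mu> \<longleftrightarrow>
     (\<exists>i\<in>{1..k}. 0 < \<alpha> i - \<mu> \<and> (\<forall>j\<in>{1..k} - {i}. \<alpha> j - \<mu> < 0))"

definition jacobi_coordinates ::
  "real^'n \<Rightarrow> (nat \<Rightarrow> real^'n) \<Rightarrow> (nat \<Rightarrow> real) \<Rightarrow> real^'n \<Rightarrow> real set" where
  "jacobi_coordinates C e \<alpha> P =
     {\<mu>. (\<Prod>i=1..CARD('n). \<alpha> i - \<mu>) -
         (\<Sum>i=1..CARD('n). (frame_coord C e i P)\<^sup>2 * (\<Prod>j\<in>{1..CARD('n)} - {i}. \<alpha> j - \<mu>)) = 0}"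

definition line_through :: "real^'n \<Rightarrow> real^'n \<Rightarrow> (real^'n) set" where
  "line_through P v = {P + t *\<^sub>R v | t. True}"

definition pca_admissible ::
  "nat \<Rightarrow> (nat \<Rightarrow> real) \<Rightarrow> (nat \<Rightarrow> real^'n) \<Rightarrow> real^'n \<Rightarrow> (nat \<Rightarrow> real^'n) \<Rightarrow> nat \<Rightarrow> real^'n \<Rightarrow> bool" where
  "pca_admissible N w M P n j u \<longleftrightarrow>
     norm u = 1 \<and> (\<forall>i\<in>{1..<j}. u \<bullet> inertia N w M P (n i) = 0)"

definition restricted_pca ::
  "nat \<Rightarrow> (nat \<Rightarrow> real) \<Rightarrow> (nat \<Rightarrow> real^'n) \<Rightarrow> real^'n \<Rightarrow> (nat \<Rightarrow> real^'n) \<Rightarrow> bool" where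
  "restricted_pca N w M P n \<longleftrightarrow>
     (\<forall>j\<in>{1..CARD('n)}. pca_admissible N w M P n j (n j) \<and>
        (\<forall>u. pca_admissible N w M P n j u \<longrightarrow>
           u \<bullet> inertia N w M P u \<le> n j \<bullet> inertia N w M P (n j)))"

definition solves_restricted_pca ::
  "nat \<Rightarrow> (nat \<Rightarrow> real) \<Rightarrow> (nat \<Rightarrow> real^'n) \<Rightarrow> real^'n \<Rightarrow> (real^'n) set set \<Rightarrow> bool" where
  "solves_restricted_pca N w M P L \<longleftrightarrow> card L = CARD('n) \<and>
     (\<exists>n. restricted_pca N w M P n \<and> L = (\<lambda>i. line_through P (n i)) ` {1..CARD('n)})"

end

theory Submission
  imports Defs
begin

text \<open>
  Write \<open>p = P - C\<close>, with coordinates \<open>x\<^sub>1, \<dots>, x\<^sub>k\<close> in the principal frame at \<open>C\<close>.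
  The parallel axis formula \<open>J\<^sub>P = J\<^sub>C + m p p\<^sup>T\<close> and the choice
  \<open>\<alpha>\<^sub>i = 2 J\<^sub>1 / m - J\<^sub>i / m\<close> of the pencil give
  \<open>J\<^sub>P = 2 J\<^sub>1 I - m (diag \<alpha> - x x\<^sup>T)\<close>. The equation of the Jacobi coordinates is
  \<open>det (diag \<alpha> - x x\<^sup>T - \<lambda> I) = 0\<close>, so a Jacobi coordinate \<open>\<mu>\<close> is the same thing as an
  eigenvalue \<open>2 J\<^sub>1 - m \<mu>\<close> of \<open>J\<^sub>P\<close>. An eigenvector is \<open>(x\<^sub>i / (\<alpha>\<^sub>i - \<mu>))\<^sub>i\<close>, half the gradient
  at \<open>P\<close> of the quadric with parameter \<open>\<mu>\<close>; in the degenerate case \<open>\<mu> = \<alpha>\<^sub>a\<close> it is the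
  \<open>a\<close>-th axis. Hence the normals of the tangent hyperplanes at \<open>P\<close> form a principal frame
  at \<open>P\<close> (\<open>tangent_normals_principal_frame\<close>), and the moments decrease as the Jacobi
  coordinates increase.

  The rest holds for any principal frame with distinct moments. The moment of the points
  with respect to the hyperplane through \<open>P\<close> with unit normal \<open>n\<close> is \<open>n\<^sup>T J\<^sub>P n\<close>, whose
  extrema on the unit sphere are attained exactly at the two extreme eigenvectors, up to sign
  (\<open>best_fit_through_iff\<close>, \<open>worst_fit_through_iff\<close>). When no eigenvalue vanishes, the
  constraint of Restricted PCA says that \<open>n\<close> is orthogonal to the earlier directions, so the
  eigenvectors in order of decreasing moment solve it; the line in the direction of an
  eigenvector is the intersection of the tangent hyperplanes with the other normals
  (\<open>solves_restricted_pca_principal_frame\<close>). Finally, comparing the Rayleigh quotients of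
  \<open>J\<^sub>P\<close> and \<open>J\<^sub>C\<close> gives \<open>\<mu>\<^sub>1 \<le> \<alpha>\<^sub>k\<close> and \<open>\<alpha>\<^sub>2 \<le> \<mu>\<^sub>k \<le> \<alpha>\<^sub>1\<close>, which identifies the types
  of the extreme quadrics. All of this is independent of the dimension
  (\<open>confocal_tangents_fit\<close>).
\<close>

section \<open>Orthonormal families of full size\<close>

text \<open>Index sets \<open>{1..k}\<close> occur everywhere; rewriting their lower end to \<open>Suc 0\<close> would
  keep facts about them from matching.\<close>

declare One_nat_def [simp del]

definition orthonormal_family :: "(nat \<Rightarrow> real^'n) \<Rightarrow> bool" where
  "orthonormal_family e \<longleftrightarrow>
     (\<forall>i\<in>{1..CARD('n)}. \<forall>j\<in>{1..CARD('n)}. e i \<bullet> e j = (if i = j then 1 else 0))"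

lemma orthonormal_family_inner:
  fixes e :: "nat \<Rightarrow> real^'n"
  assumes "orthonormal_family e" "i \<in> {1..CARD('n)}" "j \<in> {1..CARD('n)}"
  shows "e i \<bullet> e j = (if i = j then 1 else 0)"
  using assms unfolding orthonormal_family_def by blast

lemma orthonormal_family_sum_inner:
  fixes e :: "nat \<Rightarrow> real^'n"
  assumes e: "orthonormal_family e" and j: "j \<in> {1..CARD('n)}"
  shows "(\<Sum>i=1..CARD('n). c i *\<^sub>R e i) \<bullet> e j = c j"
proof -
  have "(\<Sum>i=1..CARD('n). c i *\<^sub>R e i) \<bullet> e j = (\<Sum>i=1..CARD('n). if i = j then c i else 0)"
    unfolding inner_sum_left
    by (rule sum.cong) (use orthonormal_family_inner[OF e _ j] in auto)
  then show ?thesis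
    using j by (simp add: sum.delta)
qed

text \<open>Orthonormal vectors are independent, and as many independent vectors as the dimension span
  the space. The difference of the two sides is orthogonal to every \<open>e i\<close>, hence to itself.\<close>

lemma orthonormal_family_expansion:
  fixes e :: "nat \<Rightarrow> real^'n"
  assumes e: "orthonormal_family e"
  shows "(\<Sum>i=1..CARD('n). (x \<bullet> e i) *\<^sub>R e i) = x"
proof -
  let ?I = "{1..CARD('n)}"
  let ?d = "x - (\<Sum>i=1..CARD('n). (x \<bullet> e i) *\<^sub>R e i)"
  note on = orthonormal_family_inner[OF e]
  have inj: "inj_on e ?I"
  proof
    fix i j assume "i \<in> ?I" "j \<in> ?I" "e i = e j"
    then show "i = j"
      using on[of i j] on[of i i] by (auto split: if_splits)
  qed
  have "pairwise orthogonal (e ` ?I)"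
    by (auto simp: pairwise_def orthogonal_def on)
  moreover have "0 \<notin> e ` ?I"
    using on by (force simp: image_iff)
  ultimately have ind: "independent (e ` ?I)"
    by (rule pairwise_orthogonal_independent)
  have "card (e ` ?I) = dim (UNIV :: (real^'n) set)"
    by (simp add: card_image[OF inj])
  then have "UNIV \<subseteq> span (e ` ?I)"
    by (intro card_ge_dim_independent ind) auto
  then have "?d \<in> span (e ` ?I)"
    by blast
  moreover have "orthogonal ?d y" if "y \<in> e ` ?I" for y
    using that by (auto simp: orthogonal_def inner_diff_left orthonormal_family_sum_inner[OF e])
  ultimately have "orthogonal ?d ?d"
    by (rule orthogonal_to_span)
  then show ?thesis
    by (simp add: orthogonal_def)
qed

lemma orthonormal_family_parseval:
  fixes e :: "nat \<Rightarrow> real^'n"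
  assumes e: "orthonormal_family e"
  shows "u \<bullet> u = (\<Sum>i=1..CARD('n). (u \<bullet> e i)\<^sup>2)"
proof -
  have "u \<bullet> u = u \<bullet> (\<Sum>i=1..CARD('n). (u \<bullet> e i) *\<^sub>R e i)"
    by (simp only: orthonormal_family_expansion[OF e])
  also have "\<dots> = (\<Sum>i=1..CARD('n). (u \<bullet> e i)\<^sup>2)"
    by (simp add: inner_sum_right power2_eq_square)
  finally show ?thesis .
qed

text \<open>By Parseval, the difference of the two sides of the first inequality is
  \<open>\<Sum>i. (\<kappa> i - \<kappa> a) (u \<bullet> v i)\<^sup>2\<close>. It is nonnegative, and it vanishes only if all
  coordinates of \<open>u\<close> other than the \<open>a\<close>-th do.\<close>

lemma weighted_form_strict_min:
  fixes v :: "nat \<Rightarrow> real^'n"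
  assumes v: "orthonormal_family v" and a: "a \<in> {1..CARD('n)}"
    and less: "\<And>i. i \<in> {1..CARD('n)} - {a} \<Longrightarrow> \<kappa> a < \<kappa> i"
  shows weighted_form_min: "\<kappa> a * (u \<bullet> u) \<le> (\<Sum>i=1..CARD('n). \<kappa> i * (u \<bullet> v i)\<^sup>2)"
    and "(\<Sum>i=1..CARD('n). \<kappa> i * (u \<bullet> v i)\<^sup>2) \<le> \<kappa> a * (u \<bullet> u) \<Longrightarrow> u = (u \<bullet> v a) *\<^sub>R v a"
proof -
  let ?I = "{1..CARD('n)}"
  have diff: "(\<Sum>i\<in>?I. \<kappa> i * (u \<bullet> v i)\<^sup>2) - \<kappa> a * (u \<bullet> u) = (\<Sum>i\<in>?I. (\<kappa> i - \<kappa> a) * (u \<bullet> v i)\<^sup>2)"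
    unfolding orthonormal_family_parseval[OF v, of u]
    by (simp add: sum_distrib_left sum_subtractf left_diff_distrib)
  have nn: "0 \<le> (\<kappa> i - \<kappa> a) * (u \<bullet> v i)\<^sup>2" if "i \<in> ?I" for i
    using less[of i] that by (cases "i = a") auto
  then have "0 \<le> (\<Sum>i\<in>?I. (\<kappa> i - \<kappa> a) * (u \<bullet> v i)\<^sup>2)"
    by (rule sum_nonneg)
  with diff show "\<kappa> a * (u \<bullet> u) \<le> (\<Sum>i\<in>?I. \<kappa> i * (u \<bullet> v i)\<^sup>2)"
    by linarith
  assume "(\<Sum>i\<in>?I. \<kappa> i * (u \<bullet> v i)\<^sup>2) \<le> \<kappa> a * (u \<bullet> u)"
  with diff \<open>0 \<le> (\<Sum>i\<in>?I. (\<kappa> i - \<kappa> a) * (u \<bullet> v i)\<^sup>2)\<close>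
  have "(\<Sum>i\<in>?I. (\<kappa> i - \<kappa> a) * (u \<bullet> v i)\<^sup>2) = 0"
    by linarith
  then have "\<forall>i\<in>?I. (\<kappa> i - \<kappa> a) * (u \<bullet> v i)\<^sup>2 = 0"
    using sum_nonneg_eq_0_iff[of ?I "\<lambda>i. (\<kappa> i - \<kappa> a) * (u \<bullet> v i)\<^sup>2"] nn by auto
  then have z: "u \<bullet> v i = 0" if "i \<in> ?I - {a}" for i
    using less[of i] that by fastforce
  have "u = (\<Sum>i\<in>?I. (u \<bullet> v i) *\<^sub>R v i)"
    by (simp only: orthonormal_family_expansion[OF v])
  also have "\<dots> = (u \<bullet> v a) *\<^sub>R v a + (\<Sum>i\<in>?I - {a}. (u \<bullet> v i) *\<^sub>R v i)"
    using a by (intro sum.remove) auto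
  also have "(\<Sum>i\<in>?I - {a}. (u \<bullet> v i) *\<^sub>R v i) = 0"
    by (intro sum.neutral) (use z in auto)
  finally show "u = (u \<bullet> v a) *\<^sub>R v a"
    by simp
qed

section \<open>Hyperplanes through a point\<close>

definition hyperplane_at :: "real^'n \<Rightarrow> real^'n \<Rightarrow> (real^'n) set" where
  "hyperplane_at P n = {X. n \<bullet> (X - P) = 0}"

lemma hyperplane_at_scaleR:
  "c \<noteq> 0 \<Longrightarrow> hyperplane_at P (c *\<^sub>R n) = hyperplane_at P n"
  by (auto simp: hyperplane_at_def)

lemma is_hyperplane_through_iff:
  "is_hyperplane \<pi> \<and> P \<in> \<pi> \<longleftrightarrow> (\<exists>n. norm n = 1 \<and> \<pi> = hyperplane_at P n)"
proof
  assume "is_hyperplane \<pi> \<and> P \<in> \<pi>"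
  then obtain a b where ab: "a \<noteq> 0" "\<pi> = {x. a \<bullet> x = b}" "P \<in> \<pi>"
    unfolding is_hyperplane_def by blast
  then have "\<pi> = hyperplane_at P a"
    by (auto simp: hyperplane_at_def inner_diff_right)
  also have "\<dots> = hyperplane_at P ((1 / norm a) *\<^sub>R a)"
    using ab by (intro hyperplane_at_scaleR[symmetric]) auto
  finally show "\<exists>n. norm n = 1 \<and> \<pi> = hyperplane_at P n"
    using ab by (intro exI[of _ "(1 / norm a) *\<^sub>R a"]) auto
next
  assume "\<exists>n. norm n = 1 \<and> \<pi> = hyperplane_at P n"
  then obtain n where n: "norm n = 1" "\<pi> = hyperplane_at P n" by blast
  then have "n \<noteq> 0" "\<pi> = {x. n \<bullet> x = n \<bullet> P}"
    by (auto simp: hyperplane_at_def inner_diff_right)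
  then show "is_hyperplane \<pi> \<and> P \<in> \<pi>"
    unfolding is_hyperplane_def by blast
qed

text \<open>The orthogonal projection of \<open>X\<close> attains this distance; the Cauchy-Schwarz inequality
  shows that no point of the hyperplane is closer.\<close>

lemma infdist_hyperplane_at:
  assumes n: "norm n = 1"
  shows "infdist X (hyperplane_at P n) = \<bar>n \<bullet> (X - P)\<bar>"
proof (rule antisym)
  let ?Y = "X - (n \<bullet> (X - P)) *\<^sub>R n"
  have nn: "n \<bullet> n = 1"
    using n by (simp add: dot_square_norm)
  have "?Y \<in> hyperplane_at P n"
    by (simp add: hyperplane_at_def inner_diff_right nn)
  then have "infdist X (hyperplane_at P n) \<le> dist X ?Y"
    by (rule infdist_le)
  also have "\<dots> = \<bar>n \<bullet> (X - P)\<bar>"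
    by (simp add: dist_norm n)
  finally show "infdist X (hyperplane_at P n) \<le> \<bar>n \<bullet> (X - P)\<bar>" .
next
  have ne: "hyperplane_at P n \<noteq> {}"
    by (auto simp: hyperplane_at_def intro!: exI[of _ P])
  have "\<bar>n \<bullet> (X - P)\<bar> \<le> dist X Y" if "Y \<in> hyperplane_at P n" for Y
  proof -
    have "n \<bullet> (X - P) = n \<bullet> (X - Y)"
      using that by (simp add: hyperplane_at_def inner_diff_right)
    then show ?thesis
      using Cauchy_Schwarz_ineq2[of n "X - Y"] n by (simp add: dist_norm)
  qed
  then show "\<bar>n \<bullet> (X - P)\<bar> \<le> infdist X (hyperplane_at P n)"
    unfolding infdist_notempty[OF ne] by (intro cINF_greatest ne)
qed

lemma hyperplanar_moment_hyperplane_at: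
  assumes "norm n = 1"
  shows "hyperplanar_moment N w M (hyperplane_at P n) = n \<bullet> inertia N w M P n"
proof -
  have "n \<bullet> inertia N w M P n = inertia N w M P n \<bullet> n"
    by (rule inner_commute)
  then show ?thesis
    unfolding hyperplanar_moment_def infdist_hyperplane_at[OF assms] inertia_inner
    by (simp add: power2_eq_square inner_commute mult.assoc)
qed

section \<open>Fitting hyperplanes and principal component analysis in a principal frame\<close>

lemma inertia_symmetric:
  "inertia N w M P u \<bullet> v = u \<bullet> inertia N w M P v"
  by (subst (2) inner_commute) (simp add: inertia_inner mult_ac)

lemma linear_inertia: "linear (inertia N w M P)"
  by (rule linearI)
    (simp_all add: inertia_def inner_add_right distrib_left scaleR_add_left sum.distrib
      scaleR_right.sum mult_ac)

lemma principal_frame_iff: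
  fixes e :: "nat \<Rightarrow> real^'n"
  shows "principal_frame N w M Q e J \<longleftrightarrow>
    orthonormal_family e \<and> (\<forall>i\<in>{1..CARD('n)}. inertia N w M Q (e i) = J i *\<^sub>R e i)"
  by (simp add: principal_frame_def orthonormal_family_def)

lemma principal_frame_quadratic:
  fixes e :: "nat \<Rightarrow> real^'n"
  assumes "principal_frame N w M Q e J"
  shows "u \<bullet> inertia N w M Q u = (\<Sum>i=1..CARD('n). J i * (u \<bullet> e i)\<^sup>2)"
proof -
  have e: "orthonormal_family e"
    and ev: "\<And>i. i \<in> {1..CARD('n)} \<Longrightarrow> inertia N w M Q (e i) = J i *\<^sub>R e i"
    using assms by (auto simp: principal_frame_iff)
  have "u \<bullet> inertia N w M Q u = (\<Sum>i=1..CARD('n). (u \<bullet> e i) *\<^sub>R e i) \<bullet> inertia N w M Q u"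
    by (simp only: orthonormal_family_expansion[OF e])
  also have "\<dots> = (\<Sum>i=1..CARD('n). J i * (u \<bullet> e i)\<^sup>2)"
    unfolding inner_sum_left
    by (rule sum.cong)
      (simp_all add: inertia_symmetric[symmetric] ev inner_commute power2_eq_square)
  finally show ?thesis .
qed

text \<open>The sign of the factor \<open>s\<close> decides between the two fits: the best fit is the case
  \<open>s = 1\<close>, the worst fit is the case \<open>s = -1\<close>. In both, strictness of the inequality between
  the moments makes the extremal normal unique up to sign, and thereby the hyperplane unique.\<close>

lemma extremal_hyperplane_iff:
  fixes v :: "nat \<Rightarrow> real^'n"
  assumes v: "principal_frame N w M P v \<kappa>" and a: "a \<in> {1..CARD('n)}"
    and less: "\<And>i. i \<in> {1..CARD('n)} - {a} \<Longrightarrow> s * \<kappa> a < s * \<kappa> i"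
  shows "is_hyperplane \<pi> \<and> P \<in> \<pi> \<and>
      (\<forall>\<pi>'. is_hyperplane \<pi>' \<and> P \<in> \<pi>' \<longrightarrow>
         s * hyperplanar_moment N w M \<pi> \<le> s * hyperplanar_moment N w M \<pi>')
    \<longleftrightarrow> \<pi> = hyperplane_at P (v a)" (is "?L \<longleftrightarrow> ?R")
proof -
  have on: "orthonormal_family v"
    using v by (simp add: principal_frame_iff)
  have va: "norm (v a) = 1"
    using orthonormal_family_inner[OF on a a] by (simp add: norm_eq_1)
  have q: "s * hyperplanar_moment N w M (hyperplane_at P n)
      = (\<Sum>i=1..CARD('n). (s * \<kappa> i) * (n \<bullet> v i)\<^sup>2)" if "norm n = 1" for n
    by (simp add: hyperplanar_moment_hyperplane_at[OF that] principal_frame_quadratic[OF v]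
        sum_distrib_left mult.assoc)
  have ge: "s * \<kappa> a \<le> s * hyperplanar_moment N w M (hyperplane_at P n)" if "norm n = 1" for n
    using weighted_form_min[OF on a, of "\<lambda>i. s * \<kappa> i" n] less that
    by (simp add: q[OF that] norm_eq_1)
  have qa: "s * hyperplanar_moment N w M (hyperplane_at P (v a)) = s * \<kappa> a"
  proof -
    have "inertia N w M P (v a) = \<kappa> a *\<^sub>R v a"
      using v a by (simp add: principal_frame_iff)
    then show ?thesis
      using va by (simp add: hyperplanar_moment_hyperplane_at norm_eq_1)
  qed
  show ?thesis
  proof
    assume L: ?L
    then obtain n where n: "norm n = 1" "\<pi> = hyperplane_at P n"
      using is_hyperplane_through_iff by blast
    have "s * hyperplanar_moment N w M \<pi> \<le> s * \<kappa> a"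
      using L va unfolding is_hyperplane_through_iff qa[symmetric] by blast
    then have "(\<Sum>i=1..CARD('n). (s * \<kappa> i) * (n \<bullet> v i)\<^sup>2) \<le> (s * \<kappa> a) * (n \<bullet> n)"
      using n by (simp add: q norm_eq_1)
    then have eq: "n = (n \<bullet> v a) *\<^sub>R v a"
      by (intro weighted_form_strict_min(2)[OF on a, of "\<lambda>i. s * \<kappa> i"] less)
    moreover have "n \<bullet> v a \<noteq> 0"
      using eq n(1) by (metis norm_zero scale_zero_left zero_neq_one)
    ultimately show ?R
      using n(2) hyperplane_at_scaleR by metis
  next
    assume ?R
    then show ?L
      using va ge qa by (auto simp: is_hyperplane_through_iff simp flip: conj_assoc)
  qed
qed

lemma best_fit_through_iff:
  fixes v :: "nat \<Rightarrow> real^'n"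
  assumes v: "principal_frame N w M P v \<kappa>" and a: "a \<in> {1..CARD('n)}"
    and less: "\<And>i. i \<in> {1..CARD('n)} - {a} \<Longrightarrow> \<kappa> a < \<kappa> i"
  shows "best_fit_through N w M P \<pi> \<longleftrightarrow> \<pi> = hyperplane_at P (v a)"
  using extremal_hyperplane_iff[OF v a, of 1 \<pi>] less by (simp add: best_fit_through_def)

lemma worst_fit_through_iff:
  fixes v :: "nat \<Rightarrow> real^'n"
  assumes v: "principal_frame N w M P v \<kappa>" and a: "a \<in> {1..CARD('n)}"
    and less: "\<And>i. i \<in> {1..CARD('n)} - {a} \<Longrightarrow> \<kappa> i < \<kappa> a"
  shows "worst_fit_through N w M P \<pi> \<longleftrightarrow> \<pi> = hyperplane_at P (v a)"
  using extremal_hyperplane_iff[OF v a, of "-1" \<pi>] less by (simp add: worst_fit_through_def)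

text \<open>Since \<open>u \<bullet> inertia N w M P (v i) = \<kappa> i * (u \<bullet> v i)\<close> with \<open>\<kappa> i \<noteq> 0\<close>, an admissible vector in
  step \<open>j\<close> has no component along \<open>v i\<close> for \<open>i < j\<close>. Its moment is then an average of the
  \<open>\<kappa> i\<close> with \<open>i \<ge> j\<close>, none of which exceeds \<open>\<kappa> j\<close>.\<close>

lemma restricted_pca_principal_frame:
  fixes v :: "nat \<Rightarrow> real^'n"
  assumes v: "principal_frame N w M P v \<kappa>"
    and nonzero: "\<And>i. i \<in> {1..CARD('n)} \<Longrightarrow> \<kappa> i \<noteq> 0"
    and decr: "\<And>i j. \<lbrakk>i \<in> {1..CARD('n)}; j \<in> {1..CARD('n)}; i \<le> j\<rbrakk> \<Longrightarrow> \<kappa> j \<le> \<kappa> i"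
  shows "restricted_pca N w M P v"
  unfolding restricted_pca_def
proof (intro ballI conjI allI impI)
  have on: "orthonormal_family v"
    and ev: "\<And>i. i \<in> {1..CARD('n)} \<Longrightarrow> inertia N w M P (v i) = \<kappa> i *\<^sub>R v i"
    using v by (auto simp: principal_frame_iff)
  fix j assume j: "j \<in> {1..CARD('n)}"
  show "pca_admissible N w M P v j (v j)"
    using j by (auto simp: pca_admissible_def ev orthonormal_family_inner[OF on] norm_eq_1)
  fix u assume u: "pca_admissible N w M P v j u"
  have orth: "u \<bullet> v i = 0" if "i \<in> {1..CARD('n)}" "i < j" for i
  proof -
    have "u \<bullet> inertia N w M P (v i) = 0"
      using u that by (simp add: pca_admissible_def)
    then show ?thesis
      using ev[OF that(1)] nonzero[OF that(1)] by simp
  qed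
  have "u \<bullet> inertia N w M P u = (\<Sum>i=1..CARD('n). \<kappa> i * (u \<bullet> v i)\<^sup>2)"
    by (rule principal_frame_quadratic[OF v])
  also have "\<dots> \<le> (\<Sum>i=1..CARD('n). \<kappa> j * (u \<bullet> v i)\<^sup>2)"
  proof (rule sum_mono)
    fix i assume i: "i \<in> {1..CARD('n)}"
    show "\<kappa> i * (u \<bullet> v i)\<^sup>2 \<le> \<kappa> j * (u \<bullet> v i)\<^sup>2"
      using orth[OF i] decr[OF j i] by (cases "i < j") (auto intro: mult_right_mono)
  qed
  also have "\<dots> = \<kappa> j * (u \<bullet> u)"
    by (simp add: orthonormal_family_parseval[OF on, of u] sum_distrib_left)
  also have "\<dots> = \<kappa> j"
    using u by (simp add: pca_admissible_def norm_eq_1)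
  also have "\<dots> = v j \<bullet> inertia N w M P (v j)"
    using j by (simp add: ev orthonormal_family_inner[OF on])
  finally show "u \<bullet> inertia N w M P u \<le> v j \<bullet> inertia N w M P (v j)" .
qed

lemma line_through_eq_Inter_hyperplane_at:
  fixes v :: "nat \<Rightarrow> real^'n"
  assumes on: "orthonormal_family v" and i: "i \<in> {1..CARD('n)}"
  shows "line_through P (v i) = (\<Inter>j\<in>{1..CARD('n)} - {i}. hyperplane_at P (v j))"
proof (intro equalityI subsetI)
  fix X assume "X \<in> line_through P (v i)"
  then show "X \<in> (\<Inter>j\<in>{1..CARD('n)} - {i}. hyperplane_at P (v j))"
    using i by (auto simp: line_through_def hyperplane_at_def orthonormal_family_inner[OF on]
        split: if_splits)
next
  fix X assume "X \<in> (\<Inter>j\<in>{1..CARD('n)} - {i}. hyperplane_at P (v j))"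
  then have z: "(X - P) \<bullet> v j = 0" if "j \<in> {1..CARD('n)} - {i}" for j
    using that by (auto simp: hyperplane_at_def inner_commute)
  have "X - P = (\<Sum>j\<in>{1..CARD('n)}. ((X - P) \<bullet> v j) *\<^sub>R v j)"
    by (simp only: orthonormal_family_expansion[OF on])
  also have "\<dots> = ((X - P) \<bullet> v i) *\<^sub>R v i"
    using i z by (subst sum.remove[of _ i]) auto
  finally have "X = P + ((X - P) \<bullet> v i) *\<^sub>R v i"
    by (simp add: algebra_simps)
  then show "X \<in> line_through P (v i)"
    unfolding line_through_def by blast
qed

lemma card_principal_lines:
  fixes v :: "nat \<Rightarrow> real^'n"
  assumes on: "orthonormal_family v"
  shows "card ((\<lambda>i. line_through P (v i)) ` {1..CARD('n)}) = CARD('n)"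
proof -
  have "inj_on (\<lambda>i. line_through P (v i)) {1..CARD('n)}"
  proof
    fix i j assume ij: "i \<in> {1..CARD('n)}" "j \<in> {1..CARD('n)}"
      and eq: "line_through P (v i) = line_through P (v j)"
    have "P + 1 *\<^sub>R v i \<in> line_through P (v i)"
      unfolding line_through_def by blast
    then obtain t where "v i = t *\<^sub>R v j"
      unfolding eq by (auto simp: line_through_def)
    then show "i = j"
      using ij orthonormal_family_inner[OF on, of i j] orthonormal_family_inner[OF on, of i i]
        orthonormal_family_inner[OF on, of j j]
      by (auto split: if_splits)
  qed
  then show ?thesis
    by (simp add: card_image)
qed

lemma solves_restricted_pca_principal_frame:
  fixes v :: "nat \<Rightarrow> real^'n"
  assumes v: "principal_frame N w M P v \<kappa>"
    and "\<And>i. i \<in> {1..CARD('n)} \<Longrightarrow> \<kappa> i \<noteq> 0"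
    and "\<And>i j. \<lbrakk>i \<in> {1..CARD('n)}; j \<in> {1..CARD('n)}; i \<le> j\<rbrakk> \<Longrightarrow> \<kappa> j \<le> \<kappa> i"
  shows "solves_restricted_pca N w M P
    ((\<lambda>i. \<Inter>j\<in>{1..CARD('n)} - {i}. hyperplane_at P (v j)) ` {1..CARD('n)})"
proof -
  have on: "orthonormal_family v"
    using v by (simp add: principal_frame_iff)
  have "(\<lambda>i. \<Inter>j\<in>{1..CARD('n)} - {i}. hyperplane_at P (v j)) ` {1..CARD('n)}
      = (\<lambda>i. line_through P (v i)) ` {1..CARD('n)}"
    by (intro image_cong refl line_through_eq_Inter_hyperplane_at[OF on, symmetric])
  then show ?thesis
    unfolding solves_restricted_pca_def
    using restricted_pca_principal_frame[OF assms] card_principal_lines[OF on] by metis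
qed

section \<open>The operator of inertia at a point and the confocal pencil\<close>

text \<open>The analogue of the theorem of Huygens and Steiner. Expanding around \<open>C\<close>, the mixed terms
  are linear in \<open>\<Sum>j. w j *\<^sub>R (M j - C)\<close>, which vanishes by the choice of \<open>C\<close>.\<close>

lemma inertia_parallel_axis:
  fixes M :: "nat \<Rightarrow> real^'n"
  assumes m: "total_mass N w \<noteq> 0"
  defines "C \<equiv> center_of_mass N w M"
  shows "inertia N w M P u = inertia N w M C u + (total_mass N w * ((P - C) \<bullet> u)) *\<^sub>R (P - C)"
proof -
  define p where "p = P - C"
  define D where "D = (\<lambda>j. M j - C)"
  have S: "(\<Sum>j=1..N. w j *\<^sub>R D j) = 0"
  proof -
    have "(\<Sum>j=1..N. w j *\<^sub>R D j) = (\<Sum>j=1..N. w j *\<^sub>R M j) - total_mass N w *\<^sub>R C"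
      by (simp only: D_def scaleR_right_diff_distrib sum_subtractf scaleR_left.sum total_mass_def)
    then show ?thesis
      using m by (simp add: C_def center_of_mass_def)
  qed
  have S': "(\<Sum>j=1..N. w j * (D j \<bullet> u)) = 0"
    using arg_cong[OF S, of "\<lambda>x. x \<bullet> u"] by (simp add: inner_sum_left)
  have "inertia N w M P u = (\<Sum>j=1..N. (w j * ((D j - p) \<bullet> u)) *\<^sub>R (D j - p))"
    by (simp add: inertia_def D_def p_def)
  also have "\<dots> = (\<Sum>j=1..N. (w j * (D j \<bullet> u)) *\<^sub>R D j - (w j * (D j \<bullet> u)) *\<^sub>R p
      - (p \<bullet> u) *\<^sub>R (w j *\<^sub>R D j) + w j *\<^sub>R ((p \<bullet> u) *\<^sub>R p))"
    by (rule sum.cong) (auto simp: algebra_simps)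
  also have "\<dots> = inertia N w M C u - (\<Sum>j=1..N. w j * (D j \<bullet> u)) *\<^sub>R p
      - (p \<bullet> u) *\<^sub>R (\<Sum>j=1..N. w j *\<^sub>R D j) + total_mass N w *\<^sub>R ((p \<bullet> u) *\<^sub>R p)"
    by (simp only: sum.distrib sum_subtractf scaleR_left.sum scaleR_right.sum total_mass_def
        inertia_def D_def)
  finally show ?thesis
    by (simp add: S S' p_def)
qed

locale central_pencil =
  fixes M :: "nat \<Rightarrow> real^'n" and w :: "nat \<Rightarrow> real" and N :: nat
    and e :: "nat \<Rightarrow> real^'n" and J \<alpha> :: "nat \<Rightarrow> real" and m :: real
    and C P :: "real^'n"
  assumes m_pos: "0 < m"
    and m_def: "m = total_mass N w"
    and C_def: "C = center_of_mass N w M"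
    and frame: "principal_frame N w M C e J"
    and J1_pos: "0 < J 1"
    and J_mono: "strict_mono_on {1..CARD('n)} J"
    and \<alpha>_def: "\<alpha> = pencil_alpha m J"
begin

abbreviation x :: "nat \<Rightarrow> real" where "x i \<equiv> frame_coord C e i P"

text \<open>The affine order-reversing change of variable from eigenvalues of \<open>diag \<alpha> - x x\<^sup>T\<close> to
  eigenvalues of the operator of inertia at \<open>P\<close>. It takes \<open>\<alpha> i\<close> to \<open>J i\<close>.\<close>

definition moment_of :: "real \<Rightarrow> real" where "moment_of \<mu> = 2 * J 1 - m * \<mu>"

lemma moment_of_less_iff [simp]: "moment_of \<mu> < moment_of \<nu> \<longleftrightarrow> \<nu> < \<mu>"
  using m_pos by (simp add: moment_of_def)

lemma moment_of_le_iff [simp]: "moment_of \<mu> \<le> moment_of \<nu> \<longleftrightarrow> \<nu> \<le> \<mu>"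
  using m_pos by (simp add: moment_of_def)

lemma moment_of_\<alpha>: "moment_of (\<alpha> i) = J i"
  using m_pos by (simp add: moment_of_def \<alpha>_def pencil_alpha_def pencil_a_sq_def field_simps)

lemma orthonormal: "orthonormal_family e"
  using frame by (simp add: principal_frame_iff)

lemma inertia_axis: "i \<in> {1..CARD('n)} \<Longrightarrow> inertia N w M C (e i) = J i *\<^sub>R e i"
  using frame by (simp add: principal_frame_iff)

lemma inertia_P: "inertia N w M P u = inertia N w M C u + (m * ((P - C) \<bullet> u)) *\<^sub>R (P - C)"
  using inertia_parallel_axis[of N w M P u] m_pos by (simp add: m_def C_def)

lemma \<alpha>_less_iff:
  assumes "i \<in> {1..CARD('n)}" "j \<in> {1..CARD('n)}"
  shows "\<alpha> i < \<alpha> j \<longleftrightarrow> j < i"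
  using strict_mono_on_less[OF J_mono assms(2,1)] moment_of_less_iff[of "\<alpha> j" "\<alpha> i"]
  by (simp add: moment_of_\<alpha>)

lemma \<alpha>_eq_iff:
  assumes "i \<in> {1..CARD('n)}" "j \<in> {1..CARD('n)}"
  shows "\<alpha> i = \<alpha> j \<longleftrightarrow> i = j"
  using \<alpha>_less_iff[OF assms] \<alpha>_less_iff[OF assms(2,1)] by (metis less_irrefl linorder_less_linear)

lemma J_ge_J1: "i \<in> {1..CARD('n)} \<Longrightarrow> J 1 \<le> J i"
  using strict_mono_on_leD[OF J_mono, of 1 i] by auto

lemma P_expansion: "P - C = (\<Sum>i=1..CARD('n). x i *\<^sub>R e i)"
  unfolding frame_coord_def by (rule orthonormal_family_expansion[OF orthonormal, symmetric])

lemma inertia_P_quadratic: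
  "u \<bullet> inertia N w M P u = (\<Sum>i=1..CARD('n). J i * (u \<bullet> e i)\<^sup>2) + m * ((P - C) \<bullet> u)\<^sup>2"
  by (simp add: inertia_P inner_add_right principal_frame_quadratic[OF frame] power2_eq_square
      inner_commute)

text \<open>At \<open>\<mu> = \<alpha> a\<close> every product in the Jacobi equation that contains the factor
  \<open>\<alpha> a - \<mu>\<close> vanishes. The one that remains is nonzero because the \<open>\<alpha> i\<close> are distinct.\<close>

lemma degenerate_coord_zero:
  assumes \<mu>: "\<alpha> a \<in> jacobi_coordinates C e \<alpha> P" and a: "a \<in> {1..CARD('n)}"
  shows "x a = 0"
proof -
  let ?I = "{1..CARD('n)}"
  have "(\<Sum>i\<in>?I. (x i)\<^sup>2 * (\<Prod>j\<in>?I - {i}. \<alpha> j - \<alpha> a)) = (\<Prod>i\<in>?I. \<alpha> i - \<alpha> a)"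
    using \<mu> by (simp add: jacobi_coordinates_def)
  also have "\<dots> = 0"
    using a by (intro prod_zero) auto
  also have "(\<Sum>i\<in>?I. (x i)\<^sup>2 * (\<Prod>j\<in>?I - {i}. \<alpha> j - \<alpha> a)) = (x a)\<^sup>2 * (\<Prod>j\<in>?I - {a}. \<alpha> j - \<alpha> a)"
  proof -
    have "(\<Sum>i\<in>?I - {a}. (x i)\<^sup>2 * (\<Prod>j\<in>?I - {i}. \<alpha> j - \<alpha> a)) = 0"
      using a by (intro sum.neutral ballI) (auto intro!: prod_zero)
    then show ?thesis
      using a by (subst sum.remove[of _ a]) auto
  qed
  finally have "(x a)\<^sup>2 * (\<Prod>j\<in>?I - {a}. \<alpha> j - \<alpha> a) = 0" .
  moreover have "(\<Prod>j\<in>?I - {a}. \<alpha> j - \<alpha> a) \<noteq> 0"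
    using a by (auto simp: prod_zero_iff \<alpha>_eq_iff)
  ultimately show "x a = 0"
    by simp
qed

text \<open>The Jacobi equation divided by \<open>\<Prod>i. \<alpha> i - \<mu>\<close>.\<close>

lemma nondegenerate_sum_one:
  assumes \<mu>: "\<mu> \<in> jacobi_coordinates C e \<alpha> P" and nd: "\<not> degenerate_param \<alpha> CARD('n) \<mu>"
  shows "(\<Sum>i=1..CARD('n). (x i)\<^sup>2 / (\<alpha> i - \<mu>)) = 1"
proof -
  let ?I = "{1..CARD('n)}"
  let ?\<Pi> = "\<Prod>i\<in>?I. \<alpha> i - \<mu>"
  have nz: "\<alpha> i - \<mu> \<noteq> 0" if "i \<in> ?I" for i
    using nd that by (auto simp: degenerate_param_def)
  then have \<Pi>: "?\<Pi> \<noteq> 0"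
    by (simp add: prod_zero_iff)
  have "?\<Pi> = (\<Sum>i\<in>?I. (x i)\<^sup>2 * (\<Prod>j\<in>?I - {i}. \<alpha> j - \<mu>))"
    using \<mu> by (simp add: jacobi_coordinates_def)
  also have "\<dots> = (\<Sum>i\<in>?I. (x i)\<^sup>2 / (\<alpha> i - \<mu>) * ?\<Pi>)"
  proof (rule sum.cong[OF refl])
    fix i assume i: "i \<in> ?I"
    have "?\<Pi> = (\<alpha> i - \<mu>) * (\<Prod>j\<in>?I - {i}. \<alpha> j - \<mu>)"
      using i by (intro prod.remove) auto
    then show "(x i)\<^sup>2 * (\<Prod>j\<in>?I - {i}. \<alpha> j - \<mu>) = (x i)\<^sup>2 / (\<alpha> i - \<mu>) * ?\<Pi>"
      using nz[OF i] by simp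
  qed
  also have "\<dots> = (\<Sum>i\<in>?I. (x i)\<^sup>2 / (\<alpha> i - \<mu>)) * ?\<Pi>"
    by (simp only: sum_distrib_right)
  finally show ?thesis
    using \<Pi> by simp
qed

text \<open>For a nondegenerate parameter, let \<open>u\<close> have coordinates \<open>c\<^sub>i = x\<^sub>i / (\<alpha>\<^sub>i - \<mu>)\<close>. The equation
  of the quadric says \<open>(P - C) \<bullet> u = 1\<close>, so the rank one term of the operator of inertia adds
  \<open>m x\<^sub>i = m (\<alpha>\<^sub>i - \<mu>) c\<^sub>i\<close> to the \<open>i\<close>-th coordinate \<open>J\<^sub>i c\<^sub>i\<close>, and
  \<open>J\<^sub>i + m (\<alpha>\<^sub>i - \<mu>)\<close> is the same for all \<open>i\<close>. For \<open>\<mu> = \<alpha>\<^sub>a\<close> the point lies on \<open>x\<^sub>a = 0\<close>, so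
  the rank one term does not act on the \<open>a\<close>-th axis.\<close>

lemma tangent_normal_eigenvector:
  assumes \<mu>: "\<mu> \<in> jacobi_coordinates C e \<alpha> P"
  obtains v where "norm v = 1" "inertia N w M P v = moment_of \<mu> *\<^sub>R v"
    "tangent_at C e \<alpha> \<mu> P = hyperplane_at P v" "P \<in> pencil_member C e \<alpha> \<mu>"
proof (cases "degenerate_param \<alpha> CARD('n) \<mu>")
  case True
  then obtain a where a: "a \<in> {1..CARD('n)}" "\<mu> = \<alpha> a"
    by (auto simp: degenerate_param_def)
  have the: "(THE i. i \<in> {1..CARD('n)} \<and> \<mu> = \<alpha> i) = a"
    using a by (intro the_equality) (auto simp: \<alpha>_eq_iff)
  have member: "pencil_member C e \<alpha> \<mu> = {X. (X - C) \<bullet> e a = 0}"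
    using True the by (auto simp: pencil_member_def pencil_fun_def frame_coord_def)
  have xa: "(P - C) \<bullet> e a = 0"
    using degenerate_coord_zero \<mu> a by (simp add: frame_coord_def)
  then have P: "P \<in> pencil_member C e \<alpha> \<mu>"
    by (simp add: member)
  show ?thesis
  proof
    show "norm (e a) = 1"
      using orthonormal_family_inner[OF orthonormal a(1) a(1)] by (simp add: norm_eq_1)
    show "inertia N w M P (e a) = moment_of \<mu> *\<^sub>R e a"
      using xa a by (simp add: inertia_P inertia_axis moment_of_\<alpha>)
    show "tangent_at C e \<alpha> \<mu> P = hyperplane_at P (e a)"
      unfolding tangent_at_degenerate[OF True P] member
      using xa by (auto simp: hyperplane_at_def inner_diff_left inner_diff_right inner_commute)
  qed (rule P)
next
  case False
  let ?I = "{1..CARD('n)}"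
  define u where "u = (\<Sum>i\<in>?I. (x i / (\<alpha> i - \<mu>)) *\<^sub>R e i)"
  have nz: "\<alpha> i - \<mu> \<noteq> 0" if "i \<in> ?I" for i
    using False that by (auto simp: degenerate_param_def)
  note one = nondegenerate_sum_one[OF \<mu> False]
  then have P: "P \<in> pencil_member C e \<alpha> \<mu>"
    using False by (simp add: pencil_member_def pencil_fun_def)
  have uX: "u \<bullet> (X - C) = (\<Sum>i\<in>?I. x i * frame_coord C e i X / (\<alpha> i - \<mu>))" for X
    by (simp add: u_def inner_sum_left frame_coord_def inner_commute[of "e _"])
  then have uP: "u \<bullet> (P - C) = 1"
    using one by (simp add: power2_eq_square)
  then have u0: "u \<noteq> 0"
    by auto
  have tangent: "tangent_at C e \<alpha> \<mu> P = hyperplane_at P u"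
  proof -
    have "u \<bullet> (X - P) = u \<bullet> (X - C) - 1" for X
      using uP by (simp add: inner_diff_right)
    then show ?thesis
      unfolding tangent_at_nondegenerate[OF False P] hyperplane_at_def
      by (simp add: uX)
  qed
  have "inertia N w M P u = (\<Sum>i\<in>?I. (x i / (\<alpha> i - \<mu>)) *\<^sub>R J i *\<^sub>R e i) + m *\<^sub>R (P - C)"
  proof -
    have "inertia N w M C u = (\<Sum>i\<in>?I. (x i / (\<alpha> i - \<mu>)) *\<^sub>R inertia N w M C (e i))"
      unfolding u_def by (simp add: linear_sum[OF linear_inertia] linear_cmul[OF linear_inertia])
    then show ?thesis
      using uP by (simp add: inertia_P inertia_axis inner_commute)
  qed
  also have "\<dots> = (\<Sum>i\<in>?I. (x i / (\<alpha> i - \<mu>) * J i + m * x i) *\<^sub>R e i)"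
    unfolding P_expansion
    by (simp add: scaleR_right.sum scaleR_add_left sum.distrib)
  also have "\<dots> = (\<Sum>i\<in>?I. moment_of \<mu> *\<^sub>R (x i / (\<alpha> i - \<mu>)) *\<^sub>R e i)"
  proof (rule sum.cong[OF refl])
    fix i assume i: "i \<in> ?I"
    have "x i / (\<alpha> i - \<mu>) * J i + m * x i = moment_of \<mu> * (x i / (\<alpha> i - \<mu>))"
      using nz[OF i] by (simp add: moment_of_\<alpha>[of i, symmetric] moment_of_def field_simps)
    then show "(x i / (\<alpha> i - \<mu>) * J i + m * x i) *\<^sub>R e i
        = moment_of \<mu> *\<^sub>R (x i / (\<alpha> i - \<mu>)) *\<^sub>R e i"
      by simp
  qed
  also have "\<dots> = moment_of \<mu> *\<^sub>R u"
    by (simp add: u_def scaleR_right.sum)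
  finally have ev: "inertia N w M P u = moment_of \<mu> *\<^sub>R u" .
  show ?thesis
  proof
    show "norm ((1 / norm u) *\<^sub>R u) = 1"
      using u0 by simp
    show "inertia N w M P ((1 / norm u) *\<^sub>R u) = moment_of \<mu> *\<^sub>R (1 / norm u) *\<^sub>R u"
      by (simp add: linear_cmul[OF linear_inertia] ev)
    show "tangent_at C e \<alpha> \<mu> P = hyperplane_at P ((1 / norm u) *\<^sub>R u)"
      using u0 by (simp add: tangent hyperplane_at_scaleR)
  qed (rule P)
qed

text \<open>The normals are eigenvectors of a symmetric operator for distinct eigenvalues, hence
  orthogonal to each other.\<close>

lemma tangent_normals_principal_frame:
  assumes \<mu>: "inj_on \<mu> {1..CARD('n)}" "\<mu> ` {1..CARD('n)} \<subseteq> jacobi_coordinates C e \<alpha> P"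
  obtains v where "principal_frame N w M P v (\<lambda>i. moment_of (\<mu> i))"
    "\<And>i. i \<in> {1..CARD('n)} \<Longrightarrow> tangent_at C e \<alpha> (\<mu> i) P = hyperplane_at P (v i)"
proof -
  let ?I = "{1..CARD('n)}"
  have "\<forall>i\<in>?I. \<exists>v. norm v = 1 \<and> inertia N w M P v = moment_of (\<mu> i) *\<^sub>R v
      \<and> tangent_at C e \<alpha> (\<mu> i) P = hyperplane_at P v"
    using \<mu>(2) tangent_normal_eigenvector by (metis image_subset_iff)
  then obtain v where v: "\<And>i. i \<in> ?I \<Longrightarrow> norm (v i) = 1"
      "\<And>i. i \<in> ?I \<Longrightarrow> inertia N w M P (v i) = moment_of (\<mu> i) *\<^sub>R v i"
      "\<And>i. i \<in> ?I \<Longrightarrow> tangent_at C e \<alpha> (\<mu> i) P = hyperplane_at P (v i)"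
    by metis
  have "v i \<bullet> v j = 0" if ij: "i \<in> ?I" "j \<in> ?I" "i \<noteq> j" for i j
  proof -
    have "moment_of (\<mu> i) * (v i \<bullet> v j) = moment_of (\<mu> j) * (v i \<bullet> v j)"
      using inertia_symmetric[of N w M P "v i" "v j"] ij by (simp add: v)
    moreover have "moment_of (\<mu> i) \<noteq> moment_of (\<mu> j)"
      using \<mu>(1) ij m_pos by (auto simp: moment_of_def dest: inj_onD)
    ultimately show ?thesis
      by simp
  qed
  then have "principal_frame N w M P v (\<lambda>i. moment_of (\<mu> i))"
    using v by (auto simp: principal_frame_def norm_eq_1)
  then show ?thesis
    using v(3) that by blast
qed

lemma J1_le_moment:
  "J 1 * (u \<bullet> u) \<le> u \<bullet> inertia N w M P u"
proof -
  have "J 1 * (u \<bullet> u) = (\<Sum>i=1..CARD('n). J 1 * (u \<bullet> e i)\<^sup>2)"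
    by (simp add: orthonormal_family_parseval[OF orthonormal, of u] sum_distrib_left)
  also have "\<dots> \<le> (\<Sum>i=1..CARD('n). J i * (u \<bullet> e i)\<^sup>2)"
    by (intro sum_mono mult_right_mono J_ge_J1) auto
  also have "\<dots> \<le> u \<bullet> inertia N w M P u"
    using m_pos by (simp add: inertia_P_quadratic)
  finally show ?thesis .
qed

text \<open>The plane of the first two axes contains a direction orthogonal to \<open>P - C\<close>, on which the
  operators of inertia at \<open>P\<close> and at \<open>C\<close> agree. This bounds the smallest moment at \<open>P\<close> by
  \<open>J 2\<close>, as in the proof of the interlacing of eigenvalues.\<close>

lemma exists_low_moment_direction:
  assumes k: "2 \<le> CARD('n)"
  obtains u where "u \<noteq> 0" "u \<bullet> inertia N w M P u \<le> J 2 * (u \<bullet> u)"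
proof -
  let ?I = "{1..CARD('n)}"
  have I: "1 \<in> ?I" "2 \<in> ?I"
    using k by auto
  note on = orthonormal_family_inner[OF orthonormal]
  obtain c d :: real where cd: "c * x 1 + d * x 2 = 0" "c \<noteq> 0 \<or> d \<noteq> 0"
  proof (cases "x 1 = 0")
    case True
    then show ?thesis using that[of 1 0] by simp
  next
    case False
    then show ?thesis using that[of "x 2" "- x 1"] by simp
  qed
  define u where "u = c *\<^sub>R e 1 + d *\<^sub>R e 2"
  have uu: "u \<bullet> u = c\<^sup>2 + d\<^sup>2"
    using I by (simp add: u_def inner_add_left inner_add_right on power2_eq_square)
  have "(P - C) \<bullet> u = 0"
    using cd(1) by (simp add: u_def inner_add_right frame_coord_def)
  then have "u \<bullet> inertia N w M P u = u \<bullet> inertia N w M C u"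
    by (simp add: inertia_P)
  also have "inertia N w M C u = (c * J 1) *\<^sub>R e 1 + (d * J 2) *\<^sub>R e 2"
    using I by (simp add: u_def linear_add[OF linear_inertia] linear_cmul[OF linear_inertia]
        inertia_axis)
  also have "u \<bullet> \<dots> = J 1 * c\<^sup>2 + J 2 * d\<^sup>2"
    using I by (simp add: u_def inner_add_left inner_add_right on power2_eq_square)
  also have "\<dots> \<le> J 2 * (u \<bullet> u)"
    using J_ge_J1[OF I(2)] by (simp add: uu distrib_left mult_right_mono)
  finally have "u \<bullet> inertia N w M P u \<le> J 2 * (u \<bullet> u)" .
  moreover have "u \<noteq> 0"
    using uu cd(2) by (auto simp: sum_power2_eq_zero_iff)
  ultimately show ?thesis
    using that by blast
qed

text \<open>The statement in every dimension \<open>k \<ge> 2\<close>. The types of the extreme quadrics come from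
  three tests of the quadratic form at \<open>P\<close>: it is at least \<open>J 1\<close> on unit vectors
  (\<open>\<mu> k \<le> \<alpha> 1\<close>), at most \<open>J 2\<close> on some unit vector (\<open>\<alpha> 2 \<le> \<mu> k\<close>), and at least \<open>J k\<close> on
  the last axis (\<open>\<mu> 1 \<le> \<alpha> k\<close>).\<close>

theorem confocal_tangents_fit:
  fixes \<mu> :: "nat \<Rightarrow> real"
  defines "k \<equiv> CARD('n)"
  defines "T \<equiv> \<lambda>i. tangent_at C e \<alpha> (\<mu> i) P"
  assumes k: "2 \<le> k" and \<mu>: "strict_mono_on {1..k} \<mu>"
    and jac: "\<mu> ` {1..k} \<subseteq> jacobi_coordinates C e \<alpha> P"
  shows "\<And>i. i \<in> {1..k} \<Longrightarrow> P \<in> pencil_member C e \<alpha> (\<mu> i)"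
    and "two_sheeted_param \<alpha> k (\<mu> k) \<or> degenerate_param \<alpha> k (\<mu> k)"
    and "best_fit_through N w M P \<pi> \<longleftrightarrow> \<pi> = T k"
    and "ellipsoid_param \<alpha> k (\<mu> 1) \<or> degenerate_param \<alpha> k (\<mu> 1)"
    and "worst_fit_through N w M P \<pi> \<longleftrightarrow> \<pi> = T 1"
    and "solves_restricted_pca N w M P ((\<lambda>i. \<Inter>j\<in>{1..k} - {i}. T j) ` {1..k})"
proof -
  let ?I = "{1..k}"
  let ?\<kappa> = "\<lambda>i. moment_of (\<mu> i)"
  have I: "1 \<in> ?I" "2 \<in> ?I" "k \<in> ?I"
    using k by auto
  obtain v where v: "principal_frame N w M P v ?\<kappa>"
    and T: "\<And>i. i \<in> ?I \<Longrightarrow> T i = hyperplane_at P (v i)"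
    using tangent_normals_principal_frame[of \<mu>] jac strict_mono_on_imp_inj_on[OF \<mu>]
    unfolding T_def k_def by metis
  have on: "orthonormal_family v"
    and ev: "\<And>i. i \<in> ?I \<Longrightarrow> inertia N w M P (v i) = ?\<kappa> i *\<^sub>R v i"
    using v by (auto simp: principal_frame_iff k_def)
  have vv: "v i \<bullet> v i = 1" if "i \<in> ?I" for i
    using orthonormal_family_inner[OF on, of i i] that by (simp add: k_def)
  have \<mu>_less: "\<mu> i < \<mu> j" if "i \<in> ?I" "j \<in> ?I" "i < j" for i j
    using strict_mono_onD[OF \<mu>] that by blast
  show "P \<in> pencil_member C e \<alpha> (\<mu> i)" if "i \<in> ?I" for i
    using tangent_normal_eigenvector[of "\<mu> i"] jac that by (metis image_subset_iff)
  show "best_fit_through N w M P \<pi> \<longleftrightarrow> \<pi> = T k"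
    using best_fit_through_iff[OF v, of k \<pi>] I \<mu>_less T by (simp add: k_def)
  show "worst_fit_through N w M P \<pi> \<longleftrightarrow> \<pi> = T 1"
    using worst_fit_through_iff[OF v, of 1 \<pi>] I \<mu>_less T by (simp add: k_def)
  have \<kappa>_ge: "J 1 \<le> ?\<kappa> i" if "i \<in> ?I" for i
    using J1_le_moment[of "v i"] vv[OF that] ev[OF that] by simp
  show "solves_restricted_pca N w M P ((\<lambda>i. \<Inter>j\<in>?I - {i}. T j) ` ?I)"
  proof -
    have "solves_restricted_pca N w M P ((\<lambda>i. \<Inter>j\<in>?I - {i}. hyperplane_at P (v j)) ` ?I)"
      unfolding k_def
    proof (rule solves_restricted_pca_principal_frame[OF v])
      show "?\<kappa> i \<noteq> 0" if "i \<in> {1..CARD('n)}" for i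
        using \<kappa>_ge[of i] that J1_pos by (simp add: k_def)
      show "?\<kappa> j \<le> ?\<kappa> i" if "i \<in> {1..CARD('n)}" "j \<in> {1..CARD('n)}" "i \<le> j" for i j
        using \<mu>_less[of i j] that by (cases "i = j") (auto simp: k_def)
    qed
    moreover have "(\<lambda>i. \<Inter>j\<in>?I - {i}. hyperplane_at P (v j)) ` ?I = (\<lambda>i. \<Inter>j\<in>?I - {i}. T j) ` ?I"
      using T by (intro image_cong INF_cong refl) auto
    ultimately show ?thesis
      by simp
  qed
  have "\<mu> k \<le> \<alpha> 1"
    using \<kappa>_ge[OF I(3)] by (simp flip: moment_of_\<alpha>)
  moreover have "\<alpha> 2 \<le> \<mu> k"
  proof -
    obtain u where u: "u \<noteq> 0" "u \<bullet> inertia N w M P u \<le> J 2 * (u \<bullet> u)"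
      using exists_low_moment_direction k unfolding k_def by blast
    have "?\<kappa> k * (u \<bullet> u) \<le> u \<bullet> inertia N w M P u"
      unfolding principal_frame_quadratic[OF v]
      by (rule weighted_form_min[OF on, of k ?\<kappa> u]) (use I \<mu>_less in \<open>auto simp: k_def\<close>)
    also note u(2)
    finally have "?\<kappa> k \<le> J 2"
      using u(1) by simp
    then show ?thesis
      by (simp flip: moment_of_\<alpha>)
  qed
  ultimately show "two_sheeted_param \<alpha> k (\<mu> k) \<or> degenerate_param \<alpha> k (\<mu> k)"
  proof (cases "degenerate_param \<alpha> k (\<mu> k)")
    case False
    with \<open>\<mu> k \<le> \<alpha> 1\<close> \<open>\<alpha> 2 \<le> \<mu> k\<close> I have "\<mu> k < \<alpha> 1" "\<alpha> 2 < \<mu> k"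
      unfolding degenerate_param_def by (metis order_le_imp_less_or_eq)+
    moreover have "\<alpha> j \<le> \<alpha> 2" if "j \<in> ?I - {1}" for j
      using \<alpha>_less_iff[of 2 j] that I by (force simp: k_def)
    ultimately show ?thesis
      unfolding two_sheeted_param_def using I(1) by fastforce
  qed auto
  have "\<mu> 1 \<le> \<alpha> k"
  proof -
    have ee: "e k \<bullet> e k = 1"
      using orthonormal_family_inner[OF orthonormal, of k k] I by (simp add: k_def)
    have "J k \<le> e k \<bullet> inertia N w M P (e k)"
      using I m_pos ee by (simp add: inertia_P inertia_axis inner_add_right inner_commute mult.assoc k_def)
    also have "\<dots> \<le> ?\<kappa> 1"
      unfolding principal_frame_quadratic[OF v]
      using weighted_form_min[OF on, of 1 "\<lambda>i. - ?\<kappa> i" "e k"] I \<mu>_less ee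
      by (simp add: k_def sum_negf)
    finally show ?thesis
      by (simp flip: moment_of_\<alpha>)
  qed
  moreover have "\<alpha> k \<le> \<alpha> i" if "i \<in> ?I" for i
    using \<alpha>_less_iff[of i k] that I by (force simp: k_def)
  ultimately have "\<mu> 1 \<le> \<alpha> i" if "i \<in> ?I" for i
    using that by force
  then show "ellipsoid_param \<alpha> k (\<mu> 1) \<or> degenerate_param \<alpha> k (\<mu> 1)"
    unfolding ellipsoid_param_def degenerate_param_def
    by (metis diff_gt_0_iff_gt order_le_imp_less_or_eq)
qed

end

section \<open>Dimensions two and three\<close>

text \<open>There is at least one point, since the empty set lies in every hyperplane.\<close>

lemma total_mass_pos_if_not_in_hyperplane:
  fixes M :: "nat \<Rightarrow> real^'n"
  assumes "\<forall>i\<in>{1..N}. 0 < w i"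
    and "\<not> (\<exists>\<pi>. is_hyperplane \<pi> \<and> M ` {1..N} \<subseteq> \<pi>)"
  shows "0 < total_mass N w"
proof -
  have "is_hyperplane {x :: real^'n. axis undefined 1 \<bullet> x = 0}"
    unfolding is_hyperplane_def by (metis axis_eq_0_iff zero_neq_one)
  then have "{1..N} \<noteq> {}"
    using assms(2) by (metis empty_subsetI image_empty)
  then show ?thesis
    unfolding total_mass_def using assms(1) by (intro sum_pos) auto
qed

theorem corollary4p1:
  fixes M :: "nat \<Rightarrow> real^'n" and w :: "nat \<Rightarrow> real" and N :: nat
    and e :: "nat \<Rightarrow> real^'n" and J \<alpha> :: "nat \<Rightarrow> real" and m :: real
    and C P :: "real^'n"
  assumes "\<forall>i\<in>{1..N}. 0 < w i"
    and "\<not> (\<exists>\<pi>. is_hyperplane \<pi> \<and> M ` {1..N} \<subseteq> \<pi>)"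
    and "m = total_mass N w"
    and "C = center_of_mass N w M"
    and "principal_frame N w M C e J"
    and "0 < J 1"
    and "strict_mono_on {1..CARD('n)} J"
    and "\<alpha> = pencil_alpha m J"
  shows "(CARD('n) = 2 \<longrightarrow>
      (\<forall>\<mu>1 \<mu>2. \<mu>1 < \<mu>2 \<and> jacobi_coordinates C e \<alpha> P = {\<mu>1, \<mu>2} \<longrightarrow>
        (\<forall>\<mu>\<in>{\<mu>1, \<mu>2}. P \<in> pencil_member C e \<alpha> \<mu>) \<and>
        (two_sheeted_param \<alpha> 2 \<mu>2 \<or> degenerate_param \<alpha> 2 \<mu>2) \<and>
        (\<forall>\<pi>. best_fit_through N w M P \<pi> \<longleftrightarrow> \<pi> = tangent_at C e \<alpha> \<mu>2 P) \<and>
        (ellipsoid_param \<alpha> 2 \<mu>1 \<or> degenerate_param \<alpha> 2 \<mu>1) \<and>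
        (\<forall>\<pi>. worst_fit_through N w M P \<pi> \<longleftrightarrow> \<pi> = tangent_at C e \<alpha> \<mu>1 P) \<and>
        solves_restricted_pca N w M P {tangent_at C e \<alpha> \<mu>1 P, tangent_at C e \<alpha> \<mu>2 P}))
    \<and> (CARD('n) = 3 \<longrightarrow>
      (\<forall>\<mu>1 \<mu>2 \<mu>3. \<mu>1 < \<mu>2 \<and> \<mu>2 < \<mu>3 \<and> jacobi_coordinates C e \<alpha> P = {\<mu>1, \<mu>2, \<mu>3} \<longrightarrow>
        (\<forall>\<mu>\<in>{\<mu>1, \<mu>2, \<mu>3}. P \<in> pencil_member C e \<alpha> \<mu>) \<and>
        (two_sheeted_param \<alpha> 3 \<mu>3 \<or> degenerate_param \<alpha> 3 \<mu>3) \<and>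
        (\<forall>\<pi>. best_fit_through N w M P \<pi> \<longleftrightarrow> \<pi> = tangent_at C e \<alpha> \<mu>3 P) \<and>
        (ellipsoid_param \<alpha> 3 \<mu>1 \<or> degenerate_param \<alpha> 3 \<mu>1) \<and>
        (\<forall>\<pi>. worst_fit_through N w M P \<pi> \<longleftrightarrow> \<pi> = tangent_at C e \<alpha> \<mu>1 P) \<and>
        solves_restricted_pca N w M P
          {tangent_at C e \<alpha> \<mu>1 P \<inter> tangent_at C e \<alpha> \<mu>2 P,
           tangent_at C e \<alpha> \<mu>1 P \<inter> tangent_at C e \<alpha> \<mu>3 P,
           tangent_at C e \<alpha> \<mu>2 P \<inter> tangent_at C e \<alpha> \<mu>3 P}))"
proof -
  interpret central_pencil M w N e J \<alpha> m C P
    using assms total_mass_pos_if_not_in_hyperplane[OF assms(1,2)] by unfold_locales auto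
  show ?thesis
  proof (rule conjI; intro impI allI; elim conjE)
    fix \<mu>1 \<mu>2 :: real
    assume k: "CARD('n) = 2" and less: "\<mu>1 < \<mu>2"
      and jac: "jacobi_coordinates C e \<alpha> P = {\<mu>1, \<mu>2}"
    define \<mu> where "\<mu> = (\<lambda>i::nat. if i = 1 then \<mu>1 else \<mu>2)"
    let ?T = "\<lambda>\<mu>. tangent_at C e \<alpha> \<mu> P"
    have vals: "\<mu> 1 = \<mu>1" "\<mu> 2 = \<mu>2"
      by (simp_all add: \<mu>_def)
    have I: "{1..2} = {1, 2::nat}"
      by auto
    have mono: "strict_mono_on {1..CARD('n)} \<mu>"
      using less by (auto simp: k I vals strict_mono_on_def)
    have sub: "\<mu> ` {1..CARD('n)} \<subseteq> jacobi_coordinates C e \<alpha> P"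
      by (simp add: k I jac vals)
    note fit = confocal_tangents_fit[of \<mu>, OF _ mono sub, unfolded k, OF order_refl, unfolded vals]
    have diffs: "{1, 2::nat} - {1} = {2}" "{1, 2::nat} - {2} = {1}"
      by auto
    have "(\<lambda>i. \<Inter>j\<in>{1..2} - {i}. ?T (\<mu> j)) ` {1..2} = {?T \<mu>1, ?T \<mu>2}"
      unfolding I image_insert image_empty diffs by (simp add: vals insert_commute)
    then show "(\<forall>\<mu>\<in>{\<mu>1, \<mu>2}. P \<in> pencil_member C e \<alpha> \<mu>) \<and>
        (two_sheeted_param \<alpha> 2 \<mu>2 \<or> degenerate_param \<alpha> 2 \<mu>2) \<and>
        (\<forall>\<pi>. best_fit_through N w M P \<pi> \<longleftrightarrow> \<pi> = ?T \<mu>2) \<and>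
        (ellipsoid_param \<alpha> 2 \<mu>1 \<or> degenerate_param \<alpha> 2 \<mu>1) \<and>
        (\<forall>\<pi>. worst_fit_through N w M P \<pi> \<longleftrightarrow> \<pi> = ?T \<mu>1) \<and>
        solves_restricted_pca N w M P {?T \<mu>1, ?T \<mu>2}"
      using fit fit(1)[of 1] fit(1)[of 2] by (simp add: vals)
  next
    fix \<mu>1 \<mu>2 \<mu>3 :: real
    assume k: "CARD('n) = 3" and less: "\<mu>1 < \<mu>2" "\<mu>2 < \<mu>3"
      and jac: "jacobi_coordinates C e \<alpha> P = {\<mu>1, \<mu>2, \<mu>3}"
    define \<mu> where "\<mu> = (\<lambda>i::nat. if i = 1 then \<mu>1 else if i = 2 then \<mu>2 else \<mu>3)"
    let ?T = "\<lambda>\<mu>. tangent_at C e \<alpha> \<mu> P"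
    have vals: "\<mu> 1 = \<mu>1" "\<mu> 2 = \<mu>2" "\<mu> 3 = \<mu>3"
      by (simp_all add: \<mu>_def)
    have I: "{1..3} = {1, 2, 3::nat}"
      by auto
    have mono: "strict_mono_on {1..CARD('n)} \<mu>"
      using less by (auto simp: k I vals strict_mono_on_def)
    have sub: "\<mu> ` {1..CARD('n)} \<subseteq> jacobi_coordinates C e \<alpha> P"
      by (simp add: k I jac vals)
    have "2 \<le> (3::nat)"
      by simp
    note fit = confocal_tangents_fit[of \<mu>, OF _ mono sub, unfolded k, OF this, unfolded vals]
    have diffs: "{1, 2, 3::nat} - {1} = {2, 3}" "{1, 2, 3::nat} - {2} = {1, 3}"
        "{1, 2, 3::nat} - {3} = {1, 2}"
      by auto
    have "(\<lambda>i. \<Inter>j\<in>{1..3} - {i}. ?T (\<mu> j)) ` {1..3}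
        = {?T \<mu>1 \<inter> ?T \<mu>2, ?T \<mu>1 \<inter> ?T \<mu>3, ?T \<mu>2 \<inter> ?T \<mu>3}"
      unfolding I image_insert image_empty diffs by (auto simp add: vals)
    then show "(\<forall>\<mu>\<in>{\<mu>1, \<mu>2, \<mu>3}. P \<in> pencil_member C e \<alpha> \<mu>) \<and>
        (two_sheeted_param \<alpha> 3 \<mu>3 \<or> degenerate_param \<alpha> 3 \<mu>3) \<and>
        (\<forall>\<pi>. best_fit_through N w M P \<pi> \<longleftrightarrow> \<pi> = ?T \<mu>3) \<and>
        (ellipsoid_param \<alpha> 3 \<mu>1 \<or> degenerate_param \<alpha> 3 \<mu>1) \<and>
        (\<forall>\<pi>. worst_fit_through N w M P \<pi> \<longleftrightarrow> \<pi> = ?T \<mu>1) \<and>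
        solves_restricted_pca N w M P {?T \<mu>1 \<inter> ?T \<mu>2, ?T \<mu>1 \<inter> ?T \<mu>3, ?T \<mu>2 \<inter> ?T \<mu>3}"
      using fit fit(1)[of 1] fit(1)[of 2] fit(1)[of 3] by (simp add: vals)
  qed
qed

end
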